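(* $$\zeta(3) = \sum_{n=0}^{\infty} \frac{(-1)^n}{72\binom{4n}{n}\binom{3n}{n}} \cdot \frac{6120n+5265n^4+13761n^2+13878n^3+1040}{(4n+1)(4n+3)(n+1)(3n+1)^2(3n+2)^2}.$$
   Context: Here $\zeta(3)=\sum_{m=1}^{\infty} \frac{1}{m^3}$ is the value of the Riemann zeta function at $3$, and $\binom{a}{b}$ denotes the usual binomial coefficient (so $\binom{0}{0}=1$). *)

theory Defs
  imports "HOL-Analysis.Analysis"
begin

definition zeta3 :: real
  where "zeta3 = (\<Sum>m. 1 / real (Suc m) ^ 3)"

end

theory Submission
  imports Defs
begin

text \<open>
  Twice the accelerated series and twice the defining series of \<open>zeta3\<close> are the weights of two
  paths in one lattice. The pair \<open>wzF\<close>, \<open>wzG\<close> below is a Wilf--Zeilberger pair: attaching the weight \<open>wzG n k\<close> to the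
  edge from \<open>(n, k)\<close> to \<open>(n + 1, k)\<close> and the weight \<open>wzF n k\<close> to the edge from \<open>(n, k)\<close> to
  \<open>(n, k + 1)\<close>, the two ways around any unit square in the region \<open>k \<le> n\<close> have the same weight
  (\<open>wz_closed\<close>). Hence the weight of a path in that region depends only on its end
  points, and is the increment of a potential \<open>pot\<close>.

  Along the axis \<open>k = 0\<close> the weights are \<open>2 / (n + 1)^3\<close>, with total \<open>2 * zeta3\<close>. The staircase
  through the points \<open>(3 * n, n)\<close>, each reached from its predecessor by three horizontal edges
  and one vertical edge, collects twice the terms of the accelerated series
  (\<open>staircase_step\<close>, \<open>stair_weight\<close>). The two paths are joined by the vertical
  segment from \<open>(3 * n, 0)\<close> to \<open>(3 * n, n)\<close>, whose weight tends to zero (\<open>wzF_column_tendsto_0\<close>), so both series have the same sum.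
\<close>

definition wzF :: "nat \<Rightarrow> nat \<Rightarrow> real"
  where "wzF n k = (- 1) ^ k * fact k ^ 2 * fact (n - k - 1) / (fact (n + k + 1) * (real k + 1))"

definition wzG :: "nat \<Rightarrow> nat \<Rightarrow> real"
  where "wzG n k = 2 * (- 1) ^ k * fact k ^ 2 * fact (n - k) / (fact (n + k + 1) * (real n + 1) ^ 2)"

definition pot :: "nat \<Rightarrow> nat \<Rightarrow> real"
  where "pot n m = (\<Sum>j<n. wzG j 0) + (\<Sum>k<m. wzF n k)"

lemma wzG_0: "wzG n 0 = 2 * (1 / real (Suc n) ^ 3)"
  by (simp add: wzG_def power3_eq_cube power2_eq_square divide_simps) (simp add: algebra_simps)

text \<open>
  After the substitution \<open>n = k + 1 + j\<close> no truncated subtraction is left, and all four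
  weights are rational functions of \<open>k\<close> and \<open>j\<close> times one common quotient of factorials. Cancelling
  that quotient leaves an identity of rational functions.
\<close>

lemma wz_closed:
  assumes "k < n"
  shows "wzF n k + wzG n (Suc k) = wzG n k + wzF (Suc n) k"
proof -
  from assms obtain j where n: "n = k + 1 + j"
    using less_iff_Suc_add by auto
  define A B s :: real
    where "A = fact k ^ 2 * fact j" and "B = fact (2 * k + j + 2)" and "s = (- 1) ^ k"
  have B: "B > 0" by (simp add: B_def)
  define K J where "K = real k" and "J = real j"
  have KJ: "K \<ge> 0" "J \<ge> 0" by (simp_all add: K_def J_def)
  have F1: "wzF n k = s * A / (B * (K + 1))"
  proof -
    have i: "n - k - 1 = j" "n + k + 1 = 2 * k + j + 2" by (simp_all add: n)
    show ?thesis unfolding wzF_def i by (simp add: A_def B_def s_def K_def)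
  qed
  have F2: "wzF (Suc n) k = s * A * (J + 1) / (B * (2 * K + J + 3) * (K + 1))"
  proof -
    have i: "Suc n - k - 1 = Suc j" "Suc n + k + 1 = Suc (2 * k + j + 2)" by (simp_all add: n)
    show ?thesis unfolding wzF_def i fact_Suc
      by (simp add: A_def B_def s_def K_def J_def algebra_simps)
  qed
  have G1: "wzG n k = 2 * s * A * (J + 1) / (B * (K + J + 2) ^ 2)"
  proof -
    have i: "n - k = Suc j" "n + k + 1 = 2 * k + j + 2" by (simp_all add: n)
    have r: "real n + 1 = K + J + 2" by (simp add: n K_def J_def)
    show ?thesis unfolding wzG_def i r unfolding fact_Suc
      by (simp add: A_def B_def s_def J_def algebra_simps)
  qed
  have G2: "wzG n (Suc k) = - 2 * s * A * (K + 1) ^ 2 / (B * (2 * K + J + 3) * (K + J + 2) ^ 2)"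
  proof -
    have i: "n - Suc k = j" "n + Suc k + 1 = Suc (2 * k + j + 2)" by (simp_all add: n)
    have r: "real n + 1 = K + J + 2" by (simp add: n K_def J_def)
    have f: "(fact (Suc k) :: real) ^ 2 = (K + 1) ^ 2 * fact k ^ 2"
      by (simp add: K_def power_mult_distrib add.commute)
    show ?thesis unfolding wzG_def i r f unfolding fact_Suc[of "2 * k + j + 2"]
      by (simp add: A_def B_def s_def K_def J_def algebra_simps)
  qed
  have key: "1 / (K + 1) + - (2 * (K + 1) ^ 2 / ((2 * K + J + 3) * (K + J + 2) ^ 2))
      = 2 * (J + 1) / (K + J + 2) ^ 2 + (J + 1) / ((2 * K + J + 3) * (K + 1))"
  proof -
    have "K + 1 \<noteq> 0" "2 * K + J + 3 \<noteq> 0" "K + J + 2 \<noteq> 0" using KJ by auto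
    then show ?thesis by (simp add: divide_simps) algebra
  qed
  define c where "c = s * A / B"
  have "wzF n k = c * (1 / (K + 1))"
    by (simp add: F1 c_def)
  moreover have "wzF (Suc n) k = c * ((J + 1) / ((2 * K + J + 3) * (K + 1)))"
    by (simp add: F2 c_def mult_ac)
  moreover have "wzG n k = c * (2 * (J + 1) / (K + J + 2) ^ 2)"
    by (simp add: G1 c_def mult_ac)
  moreover have "wzG n (Suc k)
      = c * - (2 * (K + 1) ^ 2 / ((2 * K + J + 3) * (K + J + 2) ^ 2))"
    by (simp add: G2 c_def mult_ac)
  ultimately show ?thesis
    by (simp only: distrib_left[symmetric] key)
qed

lemma pot_Suc_right: "pot n (Suc m) = pot n m + wzF n m"
  by (simp add: pot_def)

text \<open>Moving a column of height \<open>m\<close> one step to the right sweeps over \<open>m\<close> unit squares.\<close>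

lemma pot_Suc_left:
  assumes "m \<le> n"
  shows "pot (Suc n) m = pot n m + wzG n m"
  using assms
proof (induction m)
  case 0
  show ?case by (simp add: pot_def)
next
  case (Suc m)
  then show ?case using wz_closed[of m n] by (simp add: pot_Suc_right)
qed

lemma staircase_step:
  "pot (3 * Suc n) (Suc n) - pot (3 * n) n
     = wzG (3 * n) n + wzG (3 * n + 1) n + wzG (3 * n + 2) n + wzF (3 * n + 3) n"
proof -
  have "3 * Suc n = Suc (Suc (Suc (3 * n)))" by simp
  then have "pot (3 * Suc n) (Suc n)
      = pot (3 * n) n + wzG (3 * n) n + wzG (Suc (3 * n)) n + wzG (Suc (Suc (3 * n))) n
        + wzF (Suc (Suc (Suc (3 * n)))) n"
    by (simp only: pot_Suc_right) (simp add: pot_Suc_left del: mult_Suc_right)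
  then show ?thesis by (simp add: numeral_3_eq_3)
qed

text \<open>
  In a column \<open>n\<close> the modulus of \<open>wzF n k\<close>, without its factor \<open>1 / (k + 1)\<close>, is multiplied by
  \<open>(k + 1)^2 / ((n - k - 1) * (n + k + 2))\<close> in each step, which is at most 1 while \<open>2 * (k + 1) \<le> n\<close>.
\<close>

lemma abs_wzF_le:
  assumes "0 < n" "2 * k \<le> n"
  shows "\<bar>wzF n k\<bar> \<le> 1 / (real n * (real n + 1))"
proof -
  have step: "fact k ^ 2 * fact (n - k - 1) / fact (n + k + 1) \<le> 1 / (real n * (real n + 1))"
    using assms(2)
  proof (induction k)
    case 0
    obtain m where "n = Suc m" using assms(1) gr0_implies_Suc by blast
    then show ?case by (simp add: divide_simps)
  next
    case (Suc k)
    then obtain j where n: "n = 2 * k + 2 + j" using le_Suc_ex[of "2 * Suc k" n] by auto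
    have i: "n - k - 1 = Suc (k + j)" "n - Suc k - 1 = k + j" "n + Suc k + 1 = Suc (n + k + 1)"
      by (simp_all add: n)
    define R where "R = (real k + 1) ^ 2 / ((real k + real j + 1) * (real n + real k + 2))"
    have "(real k + 1) ^ 2 \<le> (real k + real j + 1) * (real n + real k + 2)"
      unfolding power2_eq_square by (intro mult_mono) (auto simp: n)
    then have R: "R \<le> 1" "R \<ge> 0" by (auto simp: R_def divide_le_eq_1)
    have f: "(fact (Suc k) :: real) ^ 2 = (real k + 1) ^ 2 * fact k ^ 2"
      by (simp add: power_mult_distrib add.commute)
    have "fact (Suc k) ^ 2 * fact (n - Suc k - 1) / fact (n + Suc k + 1)
        = R * (fact k ^ 2 * fact (n - k - 1) / fact (n + k + 1) :: real)"
      unfolding i f unfolding fact_Suc[of "k + j"] fact_Suc[of "n + k + 1"] R_def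
      by (simp add: divide_simps add_ac)
    also have "\<dots> \<le> 1 * (fact k ^ 2 * fact (n - k - 1) / fact (n + k + 1))"
      using R by (intro mult_right_mono) auto
    also have "\<dots> \<le> 1 / (real n * (real n + 1))" using Suc by simp
    finally show ?case .
  qed
  have "\<bar>wzF n k\<bar> = fact k ^ 2 * fact (n - k - 1) / fact (n + k + 1) / (real k + 1)"
    by (simp add: wzF_def abs_mult power_abs)
  also have "\<dots> \<le> fact k ^ 2 * fact (n - k - 1) / fact (n + k + 1) / 1"
    by (intro divide_left_mono) auto
  finally show ?thesis using step by simp
qed

lemma wzF_column_tendsto_0: "(\<lambda>m. \<Sum>k<m. wzF (3 * m) k) \<longlonglongrightarrow> 0"
proof (rule Lim_null_comparison)
  have "norm (\<Sum>k<m. wzF (3 * m) k) \<le> 1 / real (Suc m)" for m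
  proof (cases "m = 0")
    case False
    have "\<bar>wzF (3 * m) k\<bar> \<le> 1 / (real (3 * m) * (real (3 * m) + 1))" if "k < m" for k
      using False that by (intro abs_wzF_le) auto
    then have "norm (\<Sum>k<m. wzF (3 * m) k)
        \<le> (\<Sum>k<m. 1 / (real (3 * m) * (real (3 * m) + 1)))"
      by (intro sum_norm_le) auto
    also have "\<dots> = 1 / (3 * (3 * real m + 1))" using False by (simp add: divide_simps)
    also have "\<dots> \<le> 1 / real (Suc m)" by (intro divide_left_mono) auto
    finally show ?thesis .
  qed simp
  then show "\<forall>\<^sub>F m in sequentially. norm (\<Sum>k<m. wzF (3 * m) k) \<le> 1 / real (Suc m)" by simp
  show "(\<lambda>m. 1 / real (Suc m)) \<longlonglongrightarrow> 0" using LIMSEQ_inverse_real_of_nat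
    by (simp add: inverse_eq_divide)
qed

lemma pot_tendsto: "(\<lambda>m. pot (3 * m) m) \<longlonglongrightarrow> 2 * zeta3"
proof -
  have "summable (\<lambda>m. 1 / real (Suc m) ^ 3)"
    using inverse_power_summable[of 3, where ?'a = real]
    by (subst summable_Suc_iff) (simp add: inverse_eq_divide)
  then have "(\<lambda>m. 1 / real (Suc m) ^ 3) sums zeta3"
    unfolding zeta3_def by (rule summable_sums)
  then have "(\<lambda>j. wzG j 0) sums (2 * zeta3)"
    unfolding wzG_0 by (rule sums_mult)
  then have "(\<lambda>n. \<Sum>j<n. wzG j 0) \<longlonglongrightarrow> 2 * zeta3" by (simp add: sums_def)
  then have "(\<lambda>m. \<Sum>j<3 * m. wzG j 0) \<longlonglongrightarrow> 2 * zeta3"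
    by (rule filterlim_compose) (auto intro!: filterlim_subseq strict_monoI)
  from tendsto_add[OF this wzF_column_tendsto_0] show ?thesis by (simp add: pot_def)
qed

lemma binomial_product:
  "real ((4 * n) choose n) * real ((3 * n) choose n) = fact (4 * n) / (fact n ^ 2 * fact (2 * n))"
proof -
  have "real ((4 * n) choose n) = fact (4 * n) / (fact n * fact (3 * n))"
    using binomial_fact[of n "4 * n", where ?'a = real] by simp
  moreover have "real ((3 * n) choose n) = fact (3 * n) / (fact n * fact (2 * n))"
    using binomial_fact[of n "3 * n", where ?'a = real] by simp
  ultimately show ?thesis by (simp add: power2_eq_square)
qed

text \<open>
  Up to the sign \<open>(- 1) ^ n\<close>, all four weights on a stair are rational functions of \<open>n\<close>
  times \<open>fact n ^ 2 * fact (2 * n) / fact (4 * n)\<close>,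
  the reciprocal of the product of the binomial coefficients; the quartic polynomial is what remains
  over the common denominator.
\<close>

lemma stair_weight:
  "wzG (3 * n) n + wzG (3 * n + 1) n + wzG (3 * n + 2) n + wzF (3 * n + 3) n
   = 2 * ((- 1) ^ n / (72 * real ((4 * n) choose n) * real ((3 * n) choose n))
      * ((6120 * real n + 5265 * real n ^ 4 + 13761 * real n ^ 2 + 13878 * real n ^ 3 + 1040)
         / ((4 * real n + 1) * (4 * real n + 3) * (real n + 1)
            * (3 * real n + 1) ^ 2 * (3 * real n + 2) ^ 2)))"
proof -
  define x where "x = real n"
  have x: "x \<ge> 0" by (simp add: x_def)
  define y z where "y = 2 * x + 1" and "z = x + 1"
  define C :: real where "C = (- 1) ^ n * (fact n ^ 2 * fact (2 * n)) / fact (4 * n)"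
  have f1: "fact (2 * n + 1) = y * (fact (2 * n) :: real)"
    by (simp add: x_def y_def algebra_simps)
  have f2: "fact (2 * n + 2) = 2 * z * y * (fact (2 * n) :: real)"
    by (simp add: x_def y_def z_def algebra_simps)
  have g1: "fact (4 * n + 1) = (4 * x + 1) * (fact (4 * n) :: real)"
    by (simp add: x_def algebra_simps)
  have g2: "fact (4 * n + 2) = 2 * y * (4 * x + 1) * (fact (4 * n) :: real)"
    by (simp add: x_def y_def algebra_simps)
  have g3: "fact (4 * n + 3) = (4 * x + 3) * (2 * y * (4 * x + 1) * (fact (4 * n) :: real))"
  proof -
    have "4 * n + 3 = Suc (4 * n + 2)" by simp
    then have "fact (4 * n + 3) = real (Suc (4 * n + 2)) * fact (4 * n + 2)"
      by (simp only: fact_Suc)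
    moreover have "real (Suc (4 * n + 2)) = 4 * x + 3" by (simp add: x_def)
    ultimately show ?thesis by (simp only: g2)
  qed
  have g4: "fact (4 * n + 4)
      = 4 * z * ((4 * x + 3) * (2 * y * (4 * x + 1) * (fact (4 * n) :: real)))"
  proof -
    have "4 * n + 4 = Suc (4 * n + 3)" by simp
    then have "fact (4 * n + 4) = real (Suc (4 * n + 3)) * fact (4 * n + 3)"
      by (simp only: fact_Suc)
    moreover have "real (Suc (4 * n + 3)) = 4 * z" by (simp add: x_def z_def)
    ultimately show ?thesis by (simp only: g3)
  qed
  have nz: "4 * x + 1 \<noteq> 0" "4 * x + 3 \<noteq> 0" "y \<noteq> 0" "z \<noteq> 0" "3 * x + 1 \<noteq> 0" "3 * x + 2 \<noteq> 0"
    using x by (auto simp: y_def z_def)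
  have G0: "wzG (3 * n) n = C * (2 / ((4 * x + 1) * (3 * x + 1) ^ 2))"
  proof -
    have i: "3 * n - n = 2 * n" "3 * n + n + 1 = 4 * n + 1" by simp_all
    have r: "real (3 * n) + 1 = 3 * x + 1" by (simp add: x_def)
    show ?thesis unfolding wzG_def i r g1 C_def by (simp add: mult_ac)
  qed
  have G1: "wzG (3 * n + 1) n = C * (1 / ((4 * x + 1) * (3 * x + 2) ^ 2))"
  proof -
    have i: "3 * n + 1 - n = 2 * n + 1" "3 * n + 1 + n + 1 = 4 * n + 2" by simp_all
    have r: "real (3 * n + 1) + 1 = 3 * x + 2" by (simp add: x_def)
    show ?thesis unfolding wzG_def i r g2 f1 C_def using nz by (simp add: divide_simps)
  qed
  have G2: "wzG (3 * n + 2) n = C * (2 / (9 * (4 * x + 3) * (4 * x + 1) * z))"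
  proof -
    have i: "3 * n + 2 - n = 2 * n + 2" "3 * n + 2 + n + 1 = 4 * n + 3" by simp_all
    have r: "real (3 * n + 2) + 1 = 3 * z" by (simp add: x_def z_def)
    show ?thesis unfolding wzG_def i r g3 f2 C_def using nz
      by (simp add: divide_simps power_mult_distrib power2_eq_square[of z])
  qed
  have F3: "wzF (3 * n + 3) n = C * (1 / (4 * (4 * x + 3) * (4 * x + 1) * z))"
  proof -
    have i: "3 * n + 3 - n - 1 = 2 * n + 2" "3 * n + 3 + n + 1 = 4 * n + 4" by simp_all
    have r: "real n + 1 = z" by (simp add: x_def z_def)
    show ?thesis unfolding wzF_def i r g4 f2 C_def using nz by (simp add: divide_simps)
  qed
  define Q where "Q = 6120 * x + 5265 * x ^ 4 + 13761 * x ^ 2 + 13878 * x ^ 3 + 1040"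
  define D where "D = (4 * x + 1) * (4 * x + 3) * z * (3 * x + 1) ^ 2 * (3 * x + 2) ^ 2"
  have key: "2 / ((4 * x + 1) * (3 * x + 1) ^ 2) + 1 / ((4 * x + 1) * (3 * x + 2) ^ 2)
      + 2 / (9 * (4 * x + 3) * (4 * x + 1) * z)
      + 1 / (4 * (4 * x + 3) * (4 * x + 1) * z) = Q / (36 * D)"
    unfolding Q_def D_def using nz by (simp add: divide_simps) (simp add: z_def, algebra)
  have coeff: "(- 1) ^ n / (72 * real ((4 * n) choose n) * real ((3 * n) choose n)) = C / 72"
    unfolding mult.assoc binomial_product C_def by simp
  show ?thesis
    unfolding coeff G0 G1 G2 F3 x_def[symmetric] z_def[symmetric] Q_def[symmetric] D_def[symmetric]
      distrib_left[symmetric] key by simp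
qed

theorem mainTheorem2:
  shows "(\<lambda>n::nat.
      (- 1) ^ n / (72 * real ((4 * n) choose n) * real ((3 * n) choose n))
      * ((6120 * real n + 5265 * real n ^ 4 + 13761 * real n ^ 2 + 13878 * real n ^ 3 + 1040)
         / ((4 * real n + 1) * (4 * real n + 3) * (real n + 1)
            * (3 * real n + 1) ^ 2 * (3 * real n + 2) ^ 2)))
    sums zeta3"
    (is "?a sums _")
proof -
  have "(\<lambda>n. pot (3 * Suc n) (Suc n) - pot (3 * n) n) sums (2 * zeta3 - pot (3 * 0) 0)"
    by (rule telescope_sums[OF pot_tendsto])
  then have "(\<lambda>n. 2 * ?a n) sums (2 * zeta3)"
    unfolding staircase_step stair_weight by (simp add: pot_def)
  then show ?thesis using sums_mult_iff[of 2 ?a zeta3] by simp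
qed

end
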